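(* Let $\mathcal{D}=(V,E,F)$ be an infinite, locally finite cellular decomposition of a surface $S$, with intersection angle $\Theta\in(0,\frac{\pi}{2}]^E$. Let $r(0)\in(0,\frac{\pi}{2})^V$ be an initial value and let $\hat T=\{\hat T_i\}_{v_i\in V}$ be a family of real numbers (write $\hat T_v=\hat T_i$ for $v=v_i$) such that $$\hat T_v>0\quad\text{for all } v\in V,$$ $$\sum_{v\in U}\hat T_v<2\sum_{e\in E(U)}\Theta(e)\quad\text{for all nonempty } U\subset V,$$ where $U$ may be finite or infinite, and $$T_i(r(0))\ge\hat T_i\quad\text{for all } v_i\in V.$$ Then there exists a solution $r(t)$, with the given initial value $r(0)$, to the flow $$\frac{\mathrm{d} r_i}{\mathrm{d} t}=\frac{T_i(r(t))-\hat T_i}{2}\,\sin(2r_i),\qquad \forall v_i\in V,$$ such that $r(t)$ converges as $t\to+\infty$ and $\lim_{t\to+\infty}T(r(t))=\hat T$.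
   Context: A cellular decomposition $\mathcal{D}=(V,E,F)$ of a surface $S$ has vertex set $V$, edge set $E$ and face set $F$. It is infinite, with vertex set $V=\{v_i\}_{i=1}^\infty$, and locally finite: $\deg(v)<+\infty$ for every $v\in V$. We write $v<e$ if the vertex $v$ is incident to the edge $e$, and $e=[v_i,v_j]$ for an edge with endpoints $v_i,v_j$. A circle pattern metric is a function $r:V\to(0,\frac{\pi}{2})$, $r_i=r(v_i)$; an intersection angle is a function $\Theta:E\to(0,\frac{\pi}{2}]$. For $U\subset V$, $E(U)$ is the set of edges incident to at least one vertex of $U$. A solution of the flow is a family $r(t)\in(0,\frac{\pi}{2})^V$, $t\in[0,\infty)$. Given $(\mathcal{D},r,\Theta)$, for each edge $e=[v_i,v_j]$ let $Q_e$ be the spherical quadrilateral (on the unit sphere) with vertices $v_i,A,v_j,B$ such that $\angle v_iAv_j=\angle v_iBv_j=\pi-\Theta(e)$, $|v_iA|=|v_iB|=r_i$, $|v_jA|=|v_jB|=r_j$; it is unique up to isometry. Let $\Theta(e,v_i)=\angle Av_iB$ be its angle at $v_i$. The cone angle at $v_i$ is $\alpha_i=\sum_{e:\,v_i<e}\Theta(e,v_i)$, and the total geodesic curvature of the circle centered at $v_i$ with radius $r_i$ is $T_i=T_i(r)=\alpha_i\cos r_i$. Write $T(r)=(T_i(r))_{v_i\in V}$. Convergence of $r(t)$ and of $T(r(t))$ is understood vertex by vertex, i.e. for each $v_i\in V$ separately. *)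

theory Defs
  imports "HOL-Analysis.Analysis"
begin

section \<open>Surfaces and their cellular decompositions\<close>

text \<open>A surface is a topological 2-manifold without boundary; compactness,
  orientability and connectedness are not required.\<close>

definition second_countable_space :: "'s topology \<Rightarrow> bool" where
  "second_countable_space S \<longleftrightarrow>
     (\<exists>\<B>. countable \<B> \<and> (\<forall>B\<in>\<B>. openin S B) \<and>
          (\<forall>U x. openin S U \<and> x \<in> U \<longrightarrow> (\<exists>B\<in>\<B>. x \<in> B \<and> B \<subseteq> U)))"

definition surface :: "'s topology \<Rightarrow> bool" where
  "surface S \<longleftrightarrow>
     Hausdorff_space S \<and> second_countable_space S \<and>
     (\<forall>x\<in>topspace S. \<exists>U. openin S U \<and> x \<in> U \<and>
        subtopology S U homeomorphic_space (euclidean :: (real ^ 2) topology))"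

text \<open>\<open>\<phi>\<close> is a characteristic map of the open cell \<open>c\<close>, with the boundary of the cell attached
  inside \<open>K\<close>. The dimension of the cell is that of the domain \<open>'b\<close>.\<close>

definition characteristic_map ::
    "'s topology \<Rightarrow> 's set \<Rightarrow> 's set \<Rightarrow> ('b::euclidean_space \<Rightarrow> 's) \<Rightarrow> bool" where
  "characteristic_map S K c \<phi> \<longleftrightarrow>
     continuous_map (top_of_set (cball 0 1)) S \<phi> \<and>
     embedding_map (top_of_set (ball 0 1)) S \<phi> \<and>
     \<phi> ` ball 0 1 = c \<and>
     \<phi> ` sphere 0 1 \<subseteq> K"

text \<open>A CW structure on \<open>S\<close>: \<open>V\<close> is the set of vertices, \<open>E\<close> the set of open edges and \<open>F\<close> the set
  of open faces, the edges and faces being subsets of \<open>S\<close>. Multiple edges (distinct open edges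
  with the same endpoints) and loops are allowed. The last two conditions are closure finiteness
  (only the faces need it) and the weak topology.\<close>

definition cells :: "'s set \<Rightarrow> 's set set \<Rightarrow> 's set set \<Rightarrow> 's set set" where
  "cells V E F = (\<lambda>v. {v}) ` V \<union> E \<union> F"

definition cellular_decomposition ::
    "'s topology \<Rightarrow> 's set \<Rightarrow> 's set set \<Rightarrow> 's set set \<Rightarrow> bool" where
  "cellular_decomposition S V E F \<longleftrightarrow>
     pairwise disjnt (cells V E F) \<and>
     \<Union>(cells V E F) = topspace S \<and>
     (\<forall>e\<in>E. \<exists>\<phi> :: real \<Rightarrow> 's. characteristic_map S V e \<phi>) \<and>
     (\<forall>f\<in>F. \<exists>\<phi> :: real ^ 2 \<Rightarrow> 's. characteristic_map S (V \<union> \<Union>E) f \<phi>) \<and>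
     (\<forall>f\<in>F. finite {c \<in> cells V E F. c \<inter> S closure_of f \<noteq> {}}) \<and>
     (\<forall>A\<subseteq>topspace S. (\<forall>c\<in>cells V E F. closedin S (A \<inter> S closure_of c)) \<longrightarrow> closedin S A)"

text \<open>The endpoints of an open edge \<open>e\<close>: two vertices, or a single one if \<open>e\<close> is a loop.\<close>

definition endpoints :: "'s topology \<Rightarrow> 's set \<Rightarrow> 's set" where
  "endpoints S e = S closure_of e - e"

definition opposite_endpoint :: "'s topology \<Rightarrow> 's set \<Rightarrow> 's \<Rightarrow> 's" where
  "opposite_endpoint S e v =
     (if endpoints S e = {v} then v else (THE w. w \<in> endpoints S e \<and> w \<noteq> v))"

definition incident_edges :: "'s topology \<Rightarrow> 's set set \<Rightarrow> 's set \<Rightarrow> 's set set" where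
  "incident_edges S E U = {e \<in> E. \<exists>v\<in>U. v \<in> endpoints S e}"

definition locally_finite_decomposition :: "'s topology \<Rightarrow> 's set \<Rightarrow> 's set set \<Rightarrow> bool" where
  "locally_finite_decomposition S V E \<longleftrightarrow> (\<forall>v\<in>V. finite (incident_edges S E {v}))"


section \<open>Spherical quadrilaterals\<close>

definition sph_dist :: "real ^ 3 \<Rightarrow> real ^ 3 \<Rightarrow> real" where
  "sph_dist x y = arccos (x \<bullet> y)"

text \<open>The initial direction at \<open>p\<close> of the great circle arc from \<open>p\<close> to \<open>x\<close>, up to a positive
  factor.\<close>

definition sph_direction :: "real ^ 3 \<Rightarrow> real ^ 3 \<Rightarrow> real ^ 3" where
  "sph_direction p x = x - (x \<bullet> p) *\<^sub>R p"

text \<open>The angle \<open>x p y\<close> at \<open>p\<close>.\<close>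

definition sph_angle :: "real ^ 3 \<Rightarrow> real ^ 3 \<Rightarrow> real ^ 3 \<Rightarrow> real" where
  "sph_angle x p y =
     arccos (sph_direction p x \<bullet> sph_direction p y /
             (norm (sph_direction p x) * norm (sph_direction p y)))"

text \<open>\<open>p\<close>, \<open>a\<close>, \<open>q\<close>, \<open>b\<close> are the consecutive vertices of the quadrilateral \<open>Q\<^sub>e\<close> of an edge with
  angle \<open>\<theta>\<close>, where \<open>p\<close> and \<open>q\<close> are the centres of the circles of radii \<open>\<rho>\<close> and \<open>\<sigma>\<close>. The condition
  \<open>a \<noteq> b\<close> says that \<open>a\<close> and \<open>b\<close> lie on different sides of the diagonal \<open>p q\<close>.\<close>

definition is_quad ::
    "real \<Rightarrow> real \<Rightarrow> real \<Rightarrow> real ^ 3 \<Rightarrow> real ^ 3 \<Rightarrow> real ^ 3 \<Rightarrow> real ^ 3 \<Rightarrow> bool" where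
  "is_quad \<theta> \<rho> \<sigma> p a q b \<longleftrightarrow>
     {p, a, q, b} \<subseteq> sphere 0 1 \<and> a \<noteq> b \<and>
     sph_angle p a q = pi - \<theta> \<and> sph_angle p b q = pi - \<theta> \<and>
     sph_dist p a = \<rho> \<and> sph_dist p b = \<rho> \<and>
     sph_dist q a = \<sigma> \<and> sph_dist q b = \<sigma>"

text \<open>The angle of \<open>Q\<^sub>e\<close> at \<open>p\<close>. It is well defined for \<open>0 < \<theta> \<le> \<pi>/2\<close> and \<open>0 < \<rho>, \<sigma> < \<pi>/2\<close>,
  where \<open>Q\<^sub>e\<close> exists, is unique up to isometry and is convex, so that its interior angle at \<open>p\<close> is
  the angle \<open>a p b\<close>.\<close>

definition quad_angle :: "real \<Rightarrow> real \<Rightarrow> real \<Rightarrow> real" where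
  "quad_angle \<theta> \<rho> \<sigma> = (THE \<alpha>. \<exists>p a q b. is_quad \<theta> \<rho> \<sigma> p a q b \<and> \<alpha> = sph_angle a p b)"


section \<open>Total geodesic curvature and its flow\<close>

text \<open>The angle \<open>\<Theta>(e,v)\<close> of \<open>Q\<^sub>e\<close> at the endpoint \<open>v\<close> of \<open>e\<close>. If \<open>e\<close> is a loop at \<open>v\<close>, then \<open>Q\<^sub>e\<close> has
  two corners at \<open>v\<close>, with equal angles, and both contribute to the cone angle.\<close>

definition edge_angle ::
    "'s topology \<Rightarrow> ('s set \<Rightarrow> real) \<Rightarrow> ('s \<Rightarrow> real) \<Rightarrow> 's set \<Rightarrow> 's \<Rightarrow> real" where
  "edge_angle S \<Theta> r e v =
     (if endpoints S e = {v} then 2 else 1) *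
     quad_angle (\<Theta> e) (r v) (r (opposite_endpoint S e v))"

definition cone_angle ::
    "'s topology \<Rightarrow> 's set set \<Rightarrow> ('s set \<Rightarrow> real) \<Rightarrow> ('s \<Rightarrow> real) \<Rightarrow> 's \<Rightarrow> real" where
  "cone_angle S E \<Theta> r v = (\<Sum>e\<in>incident_edges S E {v}. edge_angle S \<Theta> r e v)"

definition total_curvature ::
    "'s topology \<Rightarrow> 's set set \<Rightarrow> ('s set \<Rightarrow> real) \<Rightarrow> ('s \<Rightarrow> real) \<Rightarrow> 's \<Rightarrow> real" where
  "total_curvature S E \<Theta> r v = cone_angle S E \<Theta> r v * cos (r v)"

definition intersection_angle :: "'s set set \<Rightarrow> ('s set \<Rightarrow> real) \<Rightarrow> bool" where
  "intersection_angle E \<Theta> \<longleftrightarrow> (\<forall>e\<in>E. \<Theta> e \<in> {0<..pi/2})"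

definition circle_pattern_metric :: "'s set \<Rightarrow> ('s \<Rightarrow> real) \<Rightarrow> bool" where
  "circle_pattern_metric V r \<longleftrightarrow> (\<forall>v\<in>V. r v \<in> {0<..<pi/2})"

text \<open>Solutions live on the time interval \<open>[0,\<infinity>)\<close>, with the one-sided derivative at time 0.\<close>

definition flow_solution ::
    "'s topology \<Rightarrow> 's set \<Rightarrow> 's set set \<Rightarrow> ('s set \<Rightarrow> real) \<Rightarrow> ('s \<Rightarrow> real) \<Rightarrow>
     (real \<Rightarrow> 's \<Rightarrow> real) \<Rightarrow> bool" where
  "flow_solution S V E \<Theta> That r \<longleftrightarrow>
     (\<forall>t\<ge>0. circle_pattern_metric V (r t)) \<and>
     (\<forall>t\<ge>0. \<forall>v\<in>V.
        ((\<lambda>s. r s v) has_real_derivative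
           (total_curvature S E \<Theta> (r t) v - That v) / 2 * sin (2 * r t v))
         (at t within {0..}))"

end

theory Submission
  imports Defs
begin

text \<open>In the coordinates \<open>x\<^sub>i = ln (tan r\<^sub>i)\<close> the flow reads \<open>x\<^sub>i' = T\<^sub>i - That\<^sub>i\<close>. The explicit formula
  for the angles of \<open>Q\<^sub>e\<close> shows that \<open>T\<^sub>i\<close> is increasing in every \<open>x\<^sub>j\<close> with \<open>j \<noteq> i\<close> and that
  \<open>T\<^sub>i + L\<^sub>i x\<^sub>i\<close> is increasing in \<open>x\<^sub>i\<close> for a suitable constant \<open>L\<^sub>i\<close>, so the infinite system is
  cooperative. As \<open>T (r 0) \<ge> That\<close>, the constant path at \<open>r 0\<close> is a subsolution; monotone Picard
  iteration of the integrated equation \<open>x\<^sub>i' + L\<^sub>i x\<^sub>i = (T\<^sub>i - That\<^sub>i) + L\<^sub>i x\<^sub>i\<close> from it converges to a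
  global solution that is nondecreasing in time. Along this solution
  \<open>That\<^sub>i \<le> T\<^sub>i \<le> C\<^sub>i exp (- x\<^sub>i)\<close>, which bounds \<open>x\<^sub>i\<close>. Hence \<open>x\<close> converges, and \<open>T\<^sub>i - That\<^sub>i\<close> tends
  to a limit that must be \<open>0\<close>, as otherwise \<open>x\<^sub>i\<close> would be unbounded.\<close>

section \<open>The angles of a spherical quadrilateral\<close>

text \<open>The product of the determinants of \<open>(p, q, a)\<close> and \<open>(p, q, b)\<close>
  is the determinant of the matrix of mutual inner products, expanded here along its first
  row.\<close>

lemma gram_det3:
  fixes p q a b :: "real^3"
  shows "(cross3 p q \<bullet> a) * (cross3 p q \<bullet> b) =
    (p \<bullet> p) * ((q \<bullet> q) * (a \<bullet> b) - (q \<bullet> b) * (q \<bullet> a))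
    - (p \<bullet> q) * ((p \<bullet> q) * (a \<bullet> b) - (q \<bullet> b) * (p \<bullet> a))
    + (p \<bullet> b) * ((p \<bullet> q) * (q \<bullet> a) - (q \<bullet> q) * (p \<bullet> a))"
  by (simp add: cross3_def inner_vec_def sum_3 algebra_simps)

lemma norm_sph_direction:
  fixes p x :: "real^3"
  assumes "norm p = 1" "norm x = 1"
  shows "(norm (sph_direction p x))\<^sup>2 = 1 - (x \<bullet> p)\<^sup>2"
  using assms unfolding sph_direction_def power2_norm_eq_inner
  by (simp add: inner_diff_left inner_diff_right inner_commute power2_eq_square algebra_simps
      norm_eq_1)

lemma inner_sph_direction:
  fixes p x y :: "real^3"
  assumes "norm p = 1"
  shows "sph_direction p x \<bullet> sph_direction p y = x \<bullet> y - (x \<bullet> p) * (y \<bullet> p)"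
  using assms unfolding sph_direction_def
  by (simp add: inner_diff_left inner_diff_right inner_commute algebra_simps norm_eq_1)

lemma sph_dist_eq_iff:
  fixes x y :: "real^3"
  assumes "norm x = 1" "norm y = 1" "0 \<le> r" "r \<le> pi"
  shows "sph_dist x y = r \<longleftrightarrow> x \<bullet> y = cos r"
proof -
  have "\<bar>x \<bullet> y\<bar> \<le> 1"
    using Cauchy_Schwarz_ineq2[of x y] assms by simp
  then have "cos (arccos (x \<bullet> y)) = x \<bullet> y"
    by (simp add: cos_arccos abs_le_iff)
  then show ?thesis
    unfolding sph_dist_def using assms arccos_cos by metis
qed

text \<open>The spherical law of cosines. It turns angle conditions into conditions on inner
  products, to which Gram determinants apply.\<close>

lemma sph_angle_eq_iff:
  fixes p x y :: "real^3"
  assumes "norm p = 1" "norm x = 1" "norm y = 1" "x \<bullet> p = cos r" "y \<bullet> p = cos s"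
    "0 < r" "r < pi" "0 < s" "s < pi" "0 \<le> A" "A \<le> pi"
  shows "sph_angle x p y = A \<longleftrightarrow> x \<bullet> y = cos r * cos s + sin r * sin s * cos A"
proof -
  have pos: "sin r > 0" "sin s > 0"
    using assms by (auto intro: sin_gt_zero)
  have "(norm (sph_direction p x))\<^sup>2 = (sin r)\<^sup>2" "(norm (sph_direction p y))\<^sup>2 = (sin s)\<^sup>2"
    using assms by (auto simp: norm_sph_direction sin_squared_eq)
  then have n: "norm (sph_direction p x) = sin r" "norm (sph_direction p y) = sin s"
    using pos by (auto simp: power2_eq_iff_nonneg)
  let ?z = "sph_direction p x \<bullet> sph_direction p y / (sin r * sin s)"
  have z: "?z = (x \<bullet> y - cos r * cos s) / (sin r * sin s)"
    using assms by (simp add: inner_sph_direction)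
  have "\<bar>?z\<bar> \<le> 1"
    using Cauchy_Schwarz_ineq2[of "sph_direction p x" "sph_direction p y"] pos n
    by (simp add: abs_mult)
  then have "cos (arccos ?z) = ?z"
    by (intro cos_arccos) linarith+
  then have "arccos ?z = A \<longleftrightarrow> ?z = cos A"
    using assms arccos_cos by metis
  then show ?thesis
    unfolding sph_angle_def n z using pos by (auto simp: field_simps)
qed

text \<open>Since \<open>a\<close> and \<open>b\<close> have the same inner products with \<open>p\<close> and \<open>q\<close>, the Gram determinant forces
  \<open>n \<bullet> b = - (n \<bullet> a)\<close> for \<open>n = p \<times> q\<close>, which determines \<open>a \<bullet> b\<close>.\<close>

lemma quad_angle_eq:
  assumes \<theta>: "0 < \<theta>" "\<theta> \<le> pi/2" and \<rho>: "0 < \<rho>" "\<rho> < pi/2" and \<sigma>: "0 < \<sigma>" "\<sigma> < pi/2"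
  shows "quad_angle \<theta> \<rho> \<sigma> =
    2 * arctan (sin \<theta> * sin \<sigma> / (sin \<rho> * cos \<sigma> + cos \<rho> * sin \<sigma> * cos \<theta>))"
proof -
  \<comment> \<open>By the law of cosines in the triangle \<open>p a q\<close> with angle
    \<open>pi - \<theta>\<close> at \<open>a\<close>, \<open>c\<close> is the cosine of the diagonal
    \<open>p q\<close>. \<open>N\<close> and \<open>s\<close> are the sine of this diagonal times
    the cosine and the sine of \<open>P\<close>, which is half the angle at
    \<open>p\<close>.\<close>
  define c where "c = cos \<rho> * cos \<sigma> - sin \<rho> * sin \<sigma> * cos \<theta>"
  define N where "N = sin \<rho> * cos \<sigma> + cos \<rho> * sin \<sigma> * cos \<theta>"
  define s where "s = sin \<theta> * sin \<sigma>"
  define P where "P = arctan (s / N)"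
  have pos: "sin \<rho> > 0" "cos \<rho> > 0" "sin \<sigma> > 0" "cos \<sigma> > 0" "sin \<theta> > 0" "cos \<theta> \<ge> 0"
    using assms by (auto intro!: sin_gt_zero cos_gt_zero cos_ge_zero)
  have N: "N > 0" and s: "s > 0"
    unfolding N_def s_def using pos by (auto intro!: add_pos_nonneg)
  have c2: "1 - c\<^sup>2 = N\<^sup>2 + s\<^sup>2"
    unfolding c_def N_def s_def power2_diff power2_sum power_mult_distrib sin_squared_eq
    by (simp add: algebra_simps power2_eq_square)
  then have c2pos: "1 - c\<^sup>2 > 0"
    using N by (simp add: add_pos_nonneg)
  have key: "cos \<sigma> - c * cos \<rho> = sin \<rho> * N"
    using sin_cos_squared_add[of \<rho>] unfolding c_def N_def by algebra
  have P: "0 < P" "P < pi/2"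
    unfolding P_def using N s arctan_ubound by auto
  have "cos (2 * P) = 2 * (cos P)\<^sup>2 - 1"
    by (rule cos_double_cos)
  also have "(cos P)\<^sup>2 = 1 / (1 + (s / N)\<^sup>2)"
    unfolding P_def cos_arctan by (simp add: power_divide add_nonneg_nonneg)
  also have "\<dots> = N\<^sup>2 / (1 - c\<^sup>2)"
    unfolding c2 using N s by (simp add: field_simps)
  finally have cos2P: "cos (2 * P) = 2 * (N\<^sup>2 / (1 - c\<^sup>2)) - 1" .
  have angle: "sph_angle a p b = 2 * P" if Q: "is_quad \<theta> \<rho> \<sigma> p a q b" for p a q b
  proof -
    have nrm: "norm p = 1" "norm a = 1" "norm q = 1" "norm b = 1" and ab: "a \<noteq> b"
      using Q by (auto simp: is_quad_def)
    have un: "p \<bullet> p = 1" "a \<bullet> a = 1" "q \<bullet> q = 1" "b \<bullet> b = 1"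
      using nrm by (auto simp: norm_eq_1)
    have in4: "p \<bullet> a = cos \<rho>" "p \<bullet> b = cos \<rho>" "q \<bullet> a = cos \<sigma>" "q \<bullet> b = cos \<sigma>"
      using Q nrm \<rho> \<sigma> sph_dist_eq_iff unfolding is_quad_def by auto
    have "sph_angle p a q = pi - \<theta>"
      using Q by (simp add: is_quad_def)
    then have pq: "p \<bullet> q = c"
      using sph_angle_eq_iff[of a p q \<rho> \<sigma> "pi - \<theta>"] nrm in4 assms unfolding c_def by simp
    define n where "n = cross3 p q"
    define K where "K = (cos \<rho>)\<^sup>2 + (cos \<sigma>)\<^sup>2 - 2 * c * cos \<rho> * cos \<sigma>"
    have gram: "(n \<bullet> x) * (n \<bullet> y) = (1 - c\<^sup>2) * (x \<bullet> y) - K"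
      if "x \<in> {a, b}" "y \<in> {a, b}" for x y
      using that unfolding n_def gram_det3 K_def by (auto simp: un in4 pq power2_eq_square algebra_simps)
    have "(n \<bullet> a)\<^sup>2 = (n \<bullet> b)\<^sup>2"
      using gram[of a a] gram[of b b] by (simp add: power2_eq_square un)
    \<comment> \<open>Otherwise \<open>a - b\<close> is orthogonal to \<open>p\<close>,
      \<open>q\<close> and \<open>n\<close>. The Gram determinant with \<open>a - b\<close> in both
      last slots is then \<open>(1 - c\<^sup>2)\<close> times the squared norm of
      \<open>a - b\<close>, and it vanishes.\<close>
    moreover have "n \<bullet> a \<noteq> n \<bullet> b"
    proof
      assume "n \<bullet> a = n \<bullet> b"
      then have "(n \<bullet> (a - b)) * (n \<bullet> (a - b)) = 0"
        by (simp add: inner_diff_right)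
      then have "(1 - c\<^sup>2) * ((a - b) \<bullet> (a - b)) = 0"
        unfolding n_def gram_det3
        by (simp add: un pq in4 inner_diff_right[of p] inner_diff_right[of q] power2_eq_square algebra_simps
            del: inner_diff_left inner_diff_right)
      with c2pos ab show False
        by simp
    qed
    ultimately have "n \<bullet> b = - (n \<bullet> a)"
      by (auto simp: power2_eq_iff)
    then have "(1 - c\<^sup>2) * (a \<bullet> b) - K = - ((1 - c\<^sup>2) * 1 - K)"
      using gram[of a a] gram[of a b] un by simp
    then have X: "(1 - c\<^sup>2) * (a \<bullet> b + 1) = 2 * K"
      unfolding distrib_left by linarith
    have "K - (1 - c\<^sup>2) * (cos \<rho>)\<^sup>2 = (sin \<rho>)\<^sup>2 * N\<^sup>2"
      unfolding power_mult_distrib[symmetric] key[symmetric] K_def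
      by (simp add: power2_eq_square algebra_simps)
    then have "(1 - c\<^sup>2) * (a \<bullet> b + 1) = 2 * ((sin \<rho>)\<^sup>2 * N\<^sup>2 + (1 - c\<^sup>2) * (cos \<rho>)\<^sup>2)"
      using X by simp
    also have "\<dots> = (1 - c\<^sup>2) * (2 * ((sin \<rho>)\<^sup>2 * (N\<^sup>2 / (1 - c\<^sup>2)) + (cos \<rho>)\<^sup>2))"
      using c2pos by (simp add: field_simps)
    finally have "a \<bullet> b + 1 = 2 * ((sin \<rho>)\<^sup>2 * (N\<^sup>2 / (1 - c\<^sup>2)) + (cos \<rho>)\<^sup>2)"
      using c2pos by simp
    then have "a \<bullet> b = cos \<rho> * cos \<rho> + sin \<rho> * sin \<rho> * cos (2 * P)"
      unfolding cos2P power2_eq_square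
      by (simp add: algebra_simps) (use sin_cos_squared_add3[of \<rho>] in linarith)
    then show ?thesis
      using sph_angle_eq_iff[of p a b \<rho> \<rho> "2 * P"] nrm in4 assms P by (simp add: inner_commute)
  qed
  \<comment> \<open>Existence: \<open>D\<close> is the sine of the diagonal, \<open>p\<close> and
    \<open>q\<close> lie in the plane of the first two axes, and \<open>a\<close> and
    \<open>b\<close> are mirror images in that plane.\<close>
  define D where "D = sqrt (1 - c\<^sup>2)"
  have D: "D > 0" "D\<^sup>2 = 1 - c\<^sup>2"
    unfolding D_def using c2pos by auto
  have nd: "(N / D)\<^sup>2 + (s / D)\<^sup>2 = 1"
    using D(2) c2 N by (simp add: power_divide flip: add_divide_distrib)
  define p where "p = (vector [1, 0, 0] :: real^3)"
  define q where "q = (vector [c, D, 0] :: real^3)"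
  define a where "a = (vector [cos \<rho>, sin \<rho> * (N / D), sin \<rho> * (s / D)] :: real^3)"
  define b where "b = (vector [cos \<rho>, sin \<rho> * (N / D), - (sin \<rho> * (s / D))] :: real^3)"
  note defs = p_def q_def a_def b_def
  have u: "(cos \<rho>)\<^sup>2 + (sin \<rho> * (N / D))\<^sup>2 + (sin \<rho> * (s / D))\<^sup>2 = 1"
    using nd sin_cos_squared_add[of \<rho>] by algebra
  have nrm: "norm p = 1" "norm q = 1" "norm a = 1" "norm b = 1"
    using D u by (auto simp: defs norm_eq_1 inner_vec_def sum_3 simp flip: power2_eq_square)
  have qa: "c * cos \<rho> + D * (sin \<rho> * (N / D)) = cos \<sigma>"
    using key D by simp
  have inn: "p \<bullet> a = cos \<rho>" "p \<bullet> b = cos \<rho>" "q \<bullet> a = cos \<sigma>" "q \<bullet> b = cos \<sigma>" "p \<bullet> q = c"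
    using qa by (auto simp: defs inner_vec_def sum_3)
  have "a $ 3 \<noteq> b $ 3"
    using pos D s by (simp add: a_def b_def)
  then have "a \<noteq> b"
    by metis
  then have quad: "is_quad \<theta> \<rho> \<sigma> p a q b"
    using nrm inn assms sph_angle_eq_iff[of a p q \<rho> \<sigma> "pi - \<theta>"] sph_angle_eq_iff[of b p q \<rho> \<sigma> "pi - \<theta>"]
    unfolding is_quad_def by (auto simp: sph_dist_eq_iff c_def)
  have "quad_angle \<theta> \<rho> \<sigma> = 2 * P"
    unfolding quad_angle_def using quad angle by (intro the_equality) metis+
  then show ?thesis
    unfolding P_def s_def N_def .
qed

section \<open>Cooperative systems of differential equations\<close>

text \<open>The solution of \<open>u' + l * u = g\<close> with \<open>u 0 = u0\<close>, by variation
  of constants.\<close>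

definition duhamel :: "real \<Rightarrow> real \<Rightarrow> (real \<Rightarrow> real) \<Rightarrow> real \<Rightarrow> real" where
  "duhamel l u0 g t = exp (- (l * t)) * (u0 + integral {0..t} (\<lambda>s. exp (l * s) * g s))"

lemma duhamel_0 [simp]: "duhamel l u0 g 0 = u0"
  by (simp add: duhamel_def)

lemma has_real_derivative_integral_from_0:
  fixes g :: "real \<Rightarrow> real"
  assumes "continuous_on {0..} g" "0 \<le> t"
  shows "((\<lambda>t. integral {0..t} g) has_real_derivative g t) (at t within {0..})"
proof -
  have "at t within {0..} = at t within {0..t + 1}"
    by (rule at_within_nhd[of _ "{..<t + 1}"]) auto
  moreover have "continuous_on {0..t + 1} g"
    using assms(1) by (rule continuous_on_subset) auto
  ultimately show ?thesis
    using integral_has_real_derivative[of 0 "t + 1" g t] assms(2) by simp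
qed

lemma duhamel_has_real_derivative:
  assumes "continuous_on {0..} g" "0 \<le> t"
  shows "(duhamel l u0 g has_real_derivative g t - l * duhamel l u0 g t) (at t within {0..})"
proof -
  have "continuous_on {0..} (\<lambda>s. exp (l * s) * g s)"
    using assms(1) by (intro continuous_intros)
  note d = has_real_derivative_integral_from_0[OF this assms(2)]
  have e: "((\<lambda>t. exp (- (l * t))) has_real_derivative - l * exp (- (l * t))) (at t within {0..})"
    by (auto intro!: derivative_eq_intros)
  show ?thesis
    unfolding duhamel_def[abs_def]
    by (rule DERIV_cong[OF DERIV_mult[OF e DERIV_add[OF DERIV_const d]]])
      (simp add: exp_minus field_simps)
qed

lemma integrable_exp_mult:
  fixes g :: "real \<Rightarrow> real"
  assumes "continuous_on {0..} g"
  shows "(\<lambda>s. exp (l * s) * g s) integrable_on {0..t}"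
  by (intro integrable_continuous_real continuous_intros continuous_on_subset[OF assms]) auto

lemma duhamel_mono:
  assumes "continuous_on {0..} g" "continuous_on {0..} h" "\<And>s. 0 \<le> s \<Longrightarrow> g s \<le> h s"
  shows "duhamel l u0 g t \<le> duhamel l u0 h t"
  unfolding duhamel_def
  by (intro mult_left_mono add_left_mono integral_le integrable_exp_mult assms) (auto intro: assms)

text \<open>Bounding \<open>g\<close> by its final value \<open>g t\<close> in the integral makes
  \<open>l * u t\<close> at most a convex combination of \<open>l * u0\<close> and
  \<open>g t\<close>, where \<open>u\<close> is the Duhamel solution. Both are at most
  \<open>g t\<close>, so the derivative \<open>g t - l * u t\<close> is nonnegative.\<close>

lemma duhamel_slope_nonneg:
  assumes g: "continuous_on {0..} g" and mono: "\<And>s. 0 \<le> s \<Longrightarrow> s \<le> t \<Longrightarrow> g s \<le> g t"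
    and l: "0 \<le> l" and g0: "l * u0 \<le> g t" and t: "0 \<le> t"
  shows "0 \<le> g t - l * duhamel l u0 g t"
proof -
  have "((\<lambda>s. l * exp (l * s)) has_integral exp (l * t) - exp (l * 0)) {0..t}"
    by (rule fundamental_theorem_of_calculus[OF t])
      (auto intro!: derivative_eq_intros simp flip: has_real_derivative_iff_has_vector_derivative)
  from has_integral_mult_right[OF this, of "g t"]
  have I: "((\<lambda>s. g t * (l * exp (l * s))) has_integral g t * (exp (l * t) - 1)) {0..t}"
    by simp
  have "l * integral {0..t} (\<lambda>s. exp (l * s) * g s) = integral {0..t} (\<lambda>s. l * (exp (l * s) * g s))"
    by simp
  also have "\<dots> \<le> integral {0..t} (\<lambda>s. g t * (l * exp (l * s)))"
  proof (rule integral_le)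
    show "(\<lambda>s. l * (exp (l * s) * g s)) integrable_on {0..t}"
      using integrable_on_cmult_left[OF integrable_exp_mult[OF g]] by simp
    show "(\<lambda>s. g t * (l * exp (l * s))) integrable_on {0..t}"
      using I by blast
    show "l * (exp (l * s) * g s) \<le> g t * (l * exp (l * s))" if "s \<in> {0..t}" for s
      using mult_left_mono[OF mono[of s], of "l * exp (l * s)"] that l by (simp add: ac_simps)
  qed
  also have "\<dots> = g t * (exp (l * t) - 1)"
    using I by (rule integral_unique)
  finally have "l * (u0 + integral {0..t} (\<lambda>s. exp (l * s) * g s)) \<le> exp (l * t) * g t"
    using g0 by (simp add: algebra_simps)
  from mult_left_mono[OF this, of "exp (- (l * t))"]
  show ?thesis
    unfolding duhamel_def by (simp add: algebra_simps flip: exp_add mult.assoc)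
qed

text \<open>Dominated convergence on \<open>{0..t}\<close>; the bound \<open>B\<close> may depend on
  \<open>t\<close>.\<close>

lemma duhamel_tendsto:
  assumes g: "\<And>n. continuous_on {0..} (g n)"
    and lo: "\<And>n s. 0 \<le> s \<Longrightarrow> s \<le> t \<Longrightarrow> \<bar>g n s\<bar> \<le> B"
    and lim: "\<And>s. 0 \<le> s \<Longrightarrow> (\<lambda>n. g n s) \<longlonglongrightarrow> h s"
  shows "(\<lambda>n. duhamel l u0 (g n) t) \<longlonglongrightarrow> duhamel l u0 h t"
proof -
  have "(\<lambda>n. integral {0..t} (\<lambda>s. exp (l * s) * g n s)) \<longlonglongrightarrow> integral {0..t} (\<lambda>s. exp (l * s) * h s)"
  proof (rule dominated_convergence)
    show "(\<lambda>s. exp (l * s) * g n s) integrable_on {0..t}" for n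
      using g by (rule integrable_exp_mult)
    show "(\<lambda>s. exp (l * s) * B) integrable_on {0..t}"
      by (rule integrable_exp_mult) simp
    show "norm (exp (l * s) * g n s) \<le> exp (l * s) * B" if "s \<in> {0..t}" for n s
      using lo[of s n] that by (simp add: abs_mult)
    show "(\<lambda>n. exp (l * s) * g n s) \<longlonglongrightarrow> exp (l * s) * h s" if "s \<in> {0..t}" for s
      using lim[of s] that by (intro tendsto_intros) auto
  qed
  then show ?thesis
    unfolding duhamel_def by (intro tendsto_intros)
qed

text \<open>The mean value theorem with a one-sided derivative at \<open>0\<close>. The weak bound
  \<open>\<xi> \<ge> s\<close> lets the statement cover \<open>s = t\<close>.\<close>

lemma increment_mvt:
  fixes u :: "real \<Rightarrow> real"
  assumes d: "\<And>t. 0 \<le> t \<Longrightarrow> (u has_real_derivative u' t) (at t within {0..})"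
    and st: "0 \<le> s" "s \<le> t"
  shows "\<exists>\<xi>\<ge>s. u t - u s = u' \<xi> * (t - s)"
proof (cases "s = t")
  case False
  have "\<exists>\<xi>\<in>{s<..<t}. u t - u s = u' \<xi> * (t - s)"
  proof (rule mvt_simple[where f' = "\<lambda>\<xi>. (*) (u' \<xi>)"])
    show "(u has_derivative (*) (u' \<xi>)) (at \<xi> within {s..t})" if "s \<le> \<xi>" "\<xi> \<le> t" for \<xi>
      using has_field_derivative_subset[OF d[of \<xi>], of "{s..t}"] st that
      by (auto simp: has_field_derivative_def)
  qed (use False st in auto)
  then obtain \<xi> where "\<xi> \<in> {s<..<t}" "u t - u s = u' \<xi> * (t - s)" by blast
  then show ?thesis by (intro exI[of _ \<xi>]) auto
qed (use st in auto)

text \<open>The topology on functions is the product topology, so vertexwise convergence suffices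
  for the continuity of \<open>f\<close> to apply.\<close>

lemma tendsto_fun_coordinatewise:
  fixes X :: "'c \<Rightarrow> 'a \<Rightarrow> real"
  assumes "\<And>i. ((\<lambda>n. X n i) \<longlongrightarrow> x i) F"
  shows "(X \<longlongrightarrow> x) F"
proof -
  have "limitin (product_topology (\<lambda>i. euclidean) UNIV) X x F"
    unfolding limitin_componentwise using assms by simp
  then show ?thesis
    unfolding euclidean_product_topology by simp
qed

section \<open>Monotone Picard iteration for a cooperative system\<close>

text \<open>The system is \<open>x' = f x\<close>, \<open>x 0 = x0\<close>. \<open>f_mono\<close>
  contains both cooperativity and a one-sided Lipschitz bound in the own coordinate;
  \<open>f_le\<close> rules out blow-up, and \<open>f_x0\<close> makes the constant path a
  subsolution. The constants depend on the coordinate, since vertex degrees may be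
  unbounded.\<close>

locale cooperative_flow =
  fixes f :: "('a \<Rightarrow> real) \<Rightarrow> 'a \<Rightarrow> real" and L M x0 :: "'a \<Rightarrow> real"
  assumes f_continuous: "continuous_on UNIV (\<lambda>x. f x i)"
    and f_mono: "(\<And>j. x j \<le> y j) \<Longrightarrow> f x i + L i * x i \<le> f y i + L i * y i"
    and L_nonneg: "0 \<le> L i"
    and f_le: "f x i \<le> M i"
    and f_x0: "0 \<le> f x0 i"
begin

definition source :: "(real \<Rightarrow> 'a \<Rightarrow> real) \<Rightarrow> 'a \<Rightarrow> real \<Rightarrow> real" where
  "source Y i s = f (Y s) i + L i * Y s i"

definition step :: "(real \<Rightarrow> 'a \<Rightarrow> real) \<Rightarrow> real \<Rightarrow> 'a \<Rightarrow> real" where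
  "step Y t i = duhamel (L i) (x0 i) (source Y i) t"

text \<open>The time derivative of \<open>step Y t i\<close>, read off from the linear equation that
  \<open>duhamel\<close> solves.\<close>

definition slope :: "(real \<Rightarrow> 'a \<Rightarrow> real) \<Rightarrow> 'a \<Rightarrow> real \<Rightarrow> real" where
  "slope Y i t = source Y i t - L i * step Y t i"

text \<open>The class of paths preserved by \<open>step\<close>: continuity makes the sources
  integrable, and monotonicity in time makes the slopes nonnegative.\<close>

definition rising :: "(real \<Rightarrow> 'a \<Rightarrow> real) \<Rightarrow> bool" where
  "rising Y \<longleftrightarrow> Y 0 = x0 \<and> (\<forall>i. continuous_on {0..} (\<lambda>t. Y t i)) \<and>
     (\<forall>i s t. 0 \<le> s \<longrightarrow> s \<le> t \<longrightarrow> Y s i \<le> Y t i)"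

definition picard :: "nat \<Rightarrow> real \<Rightarrow> 'a \<Rightarrow> real" where
  "picard n = (step ^^ n) (\<lambda>t. x0)"

lemma picard_simps: "picard 0 t i = x0 i" "picard (Suc n) = step (picard n)"
  by (simp_all add: picard_def)

lemma f_tendsto:
  assumes "\<And>j. ((\<lambda>n. X n j) \<longlongrightarrow> x j) F"
  shows "((\<lambda>n. f (X n) i) \<longlongrightarrow> f x i) F"
  by (rule continuous_on_tendsto_compose[OF f_continuous tendsto_fun_coordinatewise[OF assms]])
    auto

lemma continuous_on_source:
  assumes "\<And>j. continuous_on A (\<lambda>s. Y s j)"
  shows "continuous_on A (source Y i)"
proof -
  have "continuous_on A (\<lambda>s. f (Y s) i)"
    using assms unfolding continuous_on_def by (auto intro: f_tendsto)
  then show ?thesis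
    unfolding source_def by (intro continuous_intros assms)
qed

lemma rising_continuous_source: "rising Y \<Longrightarrow> continuous_on {0..} (source Y i)"
  unfolding rising_def by (blast intro: continuous_on_source)

lemma source_mono: "(\<And>j. Y s j \<le> Z t j) \<Longrightarrow> source Y i s \<le> source Z i t"
  unfolding source_def by (rule f_mono)

lemma step_has_derivative:
  assumes "rising Y" "0 \<le> t"
  shows "((\<lambda>t. step Y t i) has_real_derivative slope Y i t) (at t within {0..})"
  unfolding slope_def step_def
  using duhamel_has_real_derivative[OF rising_continuous_source[OF assms(1)] assms(2)] .

text \<open>Along a rising path the source is nondecreasing, and it is at least
  \<open>L i * x0 i\<close> because \<open>f x0 i \<ge> 0\<close>.\<close>

lemma slope_nonneg:
  assumes Y: "rising Y" and t: "0 \<le> t"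
  shows "0 \<le> slope Y i t"
  unfolding slope_def step_def
proof (rule duhamel_slope_nonneg)
  show "source Y i s \<le> source Y i t" if "0 \<le> s" "s \<le> t" for s
    using Y that unfolding rising_def by (blast intro: source_mono)
  have "x0 j \<le> Y t j" for j
    using Y t unfolding rising_def by (metis order_refl)
  then have "f x0 i + L i * x0 i \<le> source Y i t"
    unfolding source_def by (rule f_mono)
  then show "L i * x0 i \<le> source Y i t"
    using f_x0[of i] by linarith
qed (use Y t L_nonneg rising_continuous_source in auto)

lemma rising_step:
  assumes Y: "rising Y"
  shows "rising (step Y)"
proof -
  have "continuous_on {0..} (\<lambda>t. step Y t i)" for i
    using step_has_derivative[OF Y] by (intro DERIV_continuous_on) auto
  moreover have "step Y s i \<le> step Y t i" if "0 \<le> s" "s \<le> t" for i s t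
  proof -
    obtain \<xi> where \<xi>: "s \<le> \<xi>" "step Y t i - step Y s i = slope Y i \<xi> * (t - s)"
      using increment_mvt[OF step_has_derivative[OF Y] \<open>0 \<le> s\<close> \<open>s \<le> t\<close>] by blast
    then have "0 \<le> slope Y i \<xi> * (t - s)"
      using slope_nonneg[OF Y] that by (intro mult_nonneg_nonneg) auto
    with \<xi> show ?thesis by simp
  qed
  ultimately show ?thesis
    unfolding rising_def by (auto simp: step_def)
qed

lemma rising_picard: "rising (picard n)"
proof (induction n)
  case 0
  show ?case by (simp add: rising_def picard_simps picard_def)
next
  case (Suc n)
  then show ?case by (simp add: picard_simps rising_step)
qed

text \<open>The first iterate rises from \<open>x0\<close>, so it lies above the constant path;
  \<open>step\<close> is monotone and carries the inequality on.\<close>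

lemma picard_le_Suc: "0 \<le> t \<Longrightarrow> picard n t i \<le> picard (Suc n) t i"
proof (induction n arbitrary: t i)
  case 0
  then show ?case
    using rising_picard[of "Suc 0"] unfolding rising_def picard_simps(1) by (metis order_refl)
next
  case (Suc n)
  have "step (picard n) t i \<le> step (picard (Suc n)) t i"
    unfolding step_def
    by (intro duhamel_mono rising_continuous_source rising_picard source_mono Suc.IH)
  then show ?case by (simp add: picard_simps)
qed

lemma M_nonneg: "0 \<le> M i"
  using f_x0 f_le order_trans by blast

text \<open>Every iterate is a subsolution: replacing the previous iterate by the larger current one
  in the source bounds the slope by \<open>f\<close> at the current iterate, hence by
  \<open>M i\<close>.\<close>

lemma picard_lipschitz:
  assumes "0 \<le> s" "s \<le> t"
  shows "picard n t i \<le> picard n s i + M i * (t - s)"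
proof (cases n)
  case 0
  then show ?thesis using M_nonneg assms by (simp add: picard_simps)
next
  case (Suc k)
  obtain \<xi> where \<xi>: "s \<le> \<xi>" "picard n t i - picard n s i = slope (picard k) i \<xi> * (t - s)"
    using increment_mvt[OF step_has_derivative[OF rising_picard] assms]
    unfolding Suc picard_simps(2) by blast
  have "source (picard k) i \<xi> \<le> source (picard n) i \<xi>"
    unfolding Suc using \<xi> assms by (intro source_mono picard_le_Suc) auto
  moreover have "slope (picard k) i \<xi> = source (picard k) i \<xi> - L i * picard n \<xi> i"
    by (simp add: slope_def Suc picard_simps)
  ultimately have "slope (picard k) i \<xi> \<le> f (picard n \<xi>) i"
    unfolding source_def[of "picard n"] by linarith
  also have "\<dots> \<le> M i"
    by (rule f_le)
  finally show ?thesis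
    using \<xi>(2) mult_right_mono[of _ "M i" "t - s"] assms by fastforce
qed

section \<open>The limit of the iterates as a global solution\<close>

definition flow :: "real \<Rightarrow> 'a \<Rightarrow> real" where
  "flow t i = lim (\<lambda>n. picard n t i)"

lemma picard_bounds:
  assumes "0 \<le> t"
  shows "x0 i \<le> picard n t i" "picard n t i \<le> x0 i + M i * t"
proof -
  have 0: "picard n 0 i = x0 i"
    using rising_picard[of n] by (simp add: rising_def)
  show "x0 i \<le> picard n t i"
    using rising_picard[of n] assms unfolding rising_def by (metis order_refl)
  show "picard n t i \<le> x0 i + M i * t"
    using picard_lipschitz[of 0 t n i] assms 0 by simp
qed

lemma picard_tendsto:
  assumes "0 \<le> t"
  shows "(\<lambda>n. picard n t i) \<longlonglongrightarrow> flow t i"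
proof -
  have "incseq (\<lambda>n. picard n t i)"
    using picard_le_Suc assms by (intro incseq_SucI)
  moreover have "bdd_above (range (\<lambda>n. picard n t i))"
    using picard_bounds(2)[OF assms] by (intro bdd_aboveI2)
  ultimately have "convergent (\<lambda>n. picard n t i)"
    using LIMSEQ_incseq_SUP convergentI by blast
  then show ?thesis
    unfolding flow_def by (simp add: convergent_LIMSEQ_iff)
qed

lemma flow_mono: "0 \<le> s \<Longrightarrow> s \<le> t \<Longrightarrow> flow s i \<le> flow t i"
  using rising_picard unfolding rising_def
  by (intro LIMSEQ_le[OF picard_tendsto picard_tendsto]) auto

lemma flow_lipschitz:
  assumes "0 \<le> s" "s \<le> t"
  shows "flow t i \<le> flow s i + M i * (t - s)"
proof (rule LIMSEQ_le)
  show "(\<lambda>n. picard n t i) \<longlonglongrightarrow> flow t i"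
    using assms by (intro picard_tendsto) auto
  show "(\<lambda>n. picard n s i + M i * (t - s)) \<longlonglongrightarrow> flow s i + M i * (t - s)"
    using assms by (intro tendsto_intros picard_tendsto)
qed (use picard_lipschitz assms in auto)

lemma flow_0: "flow 0 = x0"
proof
  fix i
  have "picard n 0 i = x0 i" for n
    using rising_picard[of n] by (simp add: rising_def)
  then show "flow 0 i = x0 i"
    using picard_tendsto[of 0 i] by (simp add: LIMSEQ_const_iff)
qed

text \<open>The Lipschitz bound survives the pointwise limit and supplies its continuity.\<close>

lemma rising_flow: "rising flow"
proof -
  have "(M i)-lipschitz_on {0..} (\<lambda>t. flow t i)" for i
  proof (rule lipschitz_onI)
    fix s t :: real assume "s \<in> {0..}" "t \<in> {0..}"
    then show "dist (flow s i) (flow t i) \<le> M i * dist s t"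
      using flow_lipschitz[of s t i] flow_lipschitz[of t s i] flow_mono[of s t i] flow_mono[of t s i]
      by (cases "s \<le> t") (auto simp: dist_real_def)
  qed (rule M_nonneg)
  then show ?thesis
    unfolding rising_def using flow_0 flow_mono lipschitz_on_continuous_on by blast
qed

text \<open>The limit is a fixed point: pass to the limit in
  \<open>picard (Suc n) = step (picard n)\<close>.\<close>

lemma step_flow:
  assumes "0 \<le> t"
  shows "step flow t = flow t"
proof
  fix i
  have "(\<lambda>n. step (picard n) t i) \<longlonglongrightarrow> step flow t i"
    unfolding step_def
  proof (rule duhamel_tendsto)
    show "continuous_on {0..} (source (picard n) i)" for n
      by (rule rising_continuous_source[OF rising_picard])
    show "(\<lambda>n. source (picard n) i s) \<longlonglongrightarrow> source flow i s" if "0 \<le> s" for s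
      unfolding source_def using that by (intro tendsto_intros f_tendsto picard_tendsto)
    \<comment> \<open>Below, the source is at least its value at \<open>x0\<close>, as the iterates
      stay above \<open>x0\<close>; above, \<open>f\<close> is at most \<open>M i\<close> and the
      iterates grow at most linearly.\<close>
    show "\<bar>source (picard n) i s\<bar> \<le> \<bar>L i * x0 i\<bar> + \<bar>M i + L i * (x0 i + M i * t)\<bar>"
      if s: "0 \<le> s" "s \<le> t" for n s
    proof -
      have "f x0 i + L i * x0 i \<le> source (picard n) i s"
        unfolding source_def by (intro f_mono picard_bounds s)
      moreover have "picard n s i \<le> x0 i + M i * t"
        using picard_bounds(2)[OF s(1), of n i] mult_left_mono[OF s(2) M_nonneg[of i]] by linarith
      then have "source (picard n) i s \<le> M i + L i * (x0 i + M i * t)"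
        unfolding source_def by (intro add_mono f_le mult_left_mono L_nonneg)
      ultimately show ?thesis
        using f_x0[of i] by linarith
    qed
  qed
  moreover have "(\<lambda>n. step (picard n) t i) \<longlonglongrightarrow> flow t i"
    using LIMSEQ_Suc[OF picard_tendsto[OF assms, of i]] by (simp add: picard_simps)
  ultimately show "step flow t i = flow t i"
    by (rule LIMSEQ_unique)
qed

lemma slope_flow: "0 \<le> t \<Longrightarrow> slope flow i t = f (flow t) i"
  by (simp add: slope_def source_def step_flow)

lemma flow_has_derivative:
  assumes "0 \<le> t"
  shows "((\<lambda>t. flow t i) has_real_derivative f (flow t) i) (at t within {0..})"
proof -
  have "((\<lambda>t. step flow t i) has_real_derivative f (flow t) i) (at t within {0..})"
    using step_has_derivative[OF rising_flow assms] slope_flow[OF assms] by simp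
  then show ?thesis
    by (rule has_field_derivative_transform_within[where d = 1]) (use assms in \<open>auto simp: step_flow\<close>)
qed

lemma f_flow_nonneg: "0 \<le> t \<Longrightarrow> 0 \<le> f (flow t) i"
  using slope_nonneg[OF rising_flow] slope_flow by metis

section \<open>Convergence as time tends to infinity\<close>

lemma flow_converges:
  assumes B: "\<And>x i. 0 \<le> f x i \<Longrightarrow> x i \<le> B i"
  shows "\<exists>x. \<forall>i. ((\<lambda>t. flow t i) \<longlongrightarrow> x i) at_top \<and> ((\<lambda>t. f (flow t) i) \<longlongrightarrow> 0) at_top"
proof -
  have le: "flow t i \<le> B i" if "0 \<le> t" for t i
    using B f_flow_nonneg that by blast
  have "\<exists>l. ((\<lambda>t. flow t i) \<longlongrightarrow> l) at_top" for i
  proof -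
    define l where "l = (SUP t\<in>{0..}. flow t i)"
    have bdd: "bdd_above ((\<lambda>t. flow t i) ` {0..})"
      using le by (auto intro!: bdd_aboveI2)
    have "((\<lambda>t. flow t i) \<longlongrightarrow> l) at_top"
    proof (rule order_tendstoI)
      fix a assume "a < l"
      then obtain s where s: "s \<in> {0..}" "a < flow s i"
        unfolding l_def using less_cSUP_iff[OF _ bdd] by auto
      then have "\<forall>t\<ge>s. a < flow t i"
        using flow_mono[of s _ i] by fastforce
      then show "\<forall>\<^sub>F t in at_top. a < flow t i"
        by (auto simp: eventually_at_top_linorder)
    next
      fix a assume "l < a"
      then have "\<forall>t\<ge>0. flow t i < a"
        unfolding l_def using cSUP_upper[OF _ bdd] by fastforce
      then show "\<forall>\<^sub>F t in at_top. flow t i < a"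
        by (auto simp: eventually_at_top_linorder)
    qed
    then show ?thesis ..
  qed
  then obtain x where x: "\<And>i. ((\<lambda>t. flow t i) \<longlongrightarrow> x i) at_top"
    by metis
  have "((\<lambda>t. f (flow t) i) \<longlongrightarrow> 0) at_top" for i
  proof -
    have lim: "((\<lambda>t. f (flow t) i) \<longlongrightarrow> f x i) at_top"
      by (intro f_tendsto x)
    have "0 \<le> f x i"
      using f_flow_nonneg by (intro tendsto_lowerbound[OF lim])
        (auto simp: eventually_at_top_linorder)
    moreover have "\<not> 0 < f x i"
    proof
      assume pos: "0 < f x i"
      define c where "c = f x i / 2"
      have c: "0 < c" "c < f x i"
        using pos by (auto simp: c_def)
      obtain s0 where "\<And>t. s0 \<le> t \<Longrightarrow> c < f (flow t) i"
        using order_tendstoD(1)[OF lim c(2)] by (auto simp: eventually_at_top_linorder)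
      moreover define s where "s = max 0 s0"
      ultimately have s: "0 \<le> s" "\<And>t. s \<le> t \<Longrightarrow> c < f (flow t) i"
        by auto
      \<comment> \<open>Growth at speed above \<open>c\<close> from \<open>s\<close> until this
        \<open>t\<close> gains at least \<open>B i - flow s i + c\<close>, which passes the bound
        \<open>B i\<close>.\<close>
      define t where "t = s + (B i - flow s i) / c + 1"
      have "0 \<le> (B i - flow s i) / c"
        using le[OF s(1), of i] c by simp
      then have st: "s < t"
        by (simp add: t_def)
      obtain \<xi> where "s \<le> \<xi>" "flow t i - flow s i = f (flow \<xi>) i * (t - s)"
        using increment_mvt[OF flow_has_derivative s(1) less_imp_le[OF st]] by blast
      then have "c * (t - s) \<le> flow t i - flow s i"
        using s(2)[of \<xi>] st by simp
      moreover have "c * (t - s) = B i - flow s i + c"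
        using c by (simp add: t_def field_simps)
      ultimately show False
        using le[of t i] s st c by linarith
    qed
    ultimately show ?thesis
      using lim by (simp add: antisym_conv2 order_le_less)
  qed
  with x show ?thesis by blast
qed

end

section \<open>The curvature of an edge in logarithmic coordinates\<close>

text \<open>The contribution of an edge to \<open>T\<^sub>i\<close> when \<open>x = ln (tan r\<^sub>i)\<close> and \<open>y = ln (tan r\<^sub>j)\<close>.\<close>

definition edge_curvature :: "real \<Rightarrow> real \<Rightarrow> real \<Rightarrow> real" where
  "edge_curvature \<theta> x y =
     2 * arctan (sin \<theta> * sqrt (1 + exp (2 * x)) / (exp (x - y) + cos \<theta>)) / sqrt (1 + exp (2 * x))"

lemma sqrt_one_plus_exp_pos: "0 < sqrt (1 + exp (z::real))"
  by (simp add: add_pos_pos)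

text \<open>As the tangents of the radii are \<open>exp x\<close> and \<open>exp y\<close>, sines
  and cosines become explicit, and after cancellation \<open>y\<close> enters the quotient of
  \<open>quad_angle_eq\<close> only through \<open>exp (x - y)\<close>.\<close>

lemma edge_curvature_eq:
  assumes "0 < \<theta>" "\<theta> \<le> pi/2"
  shows "quad_angle \<theta> (arctan (exp x)) (arctan (exp y)) * cos (arctan (exp x)) = edge_curvature \<theta> x y"
proof -
  define A where "A = sqrt (1 + exp (2 * x))"
  define B where "B = sqrt (1 + exp (2 * y))"
  have pos: "A > 0" "B > 0"
    unfolding A_def B_def by (rule sqrt_one_plus_exp_pos)+
  have sc: "sin (arctan (exp x)) = exp x / A" "cos (arctan (exp x)) = 1 / A"
    "sin (arctan (exp y)) = exp y / B" "cos (arctan (exp y)) = 1 / B"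
    by (simp_all add: sin_arctan cos_arctan A_def B_def exp_double)
  have "cos \<theta> \<ge> 0"
    using assms by (intro cos_ge_zero) auto
  then have "exp x + exp y * cos \<theta> > 0" "exp (x - y) + cos \<theta> > 0"
    by (simp_all add: add_pos_nonneg)
  then have "sin \<theta> * (exp y / B) / (exp x / A * (1 / B) + 1 / A * (exp y / B) * cos \<theta>)
      = sin \<theta> * A / (exp (x - y) + cos \<theta>)"
    using pos by (simp add: exp_diff field_simps)
  moreover have "arctan (exp z) < pi/2" "0 < arctan (exp z)" for z :: real
    using arctan_ubound by auto
  ultimately show ?thesis
    using assms unfolding edge_curvature_def A_def[symmetric] by (simp add: quad_angle_eq sc)
qed

lemma two_arctan_le_pi: "2 * arctan z \<le> pi"
  using arctan_ubound[of z] by simp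

text \<open>Concavity of \<open>arctan\<close> on the nonnegative half-line, with
  \<open>arctan 0 = 0\<close>.\<close>

lemma arctan_scale_le:
  fixes k w :: real
  assumes "0 \<le> k" "k \<le> 1" "0 \<le> w"
  shows "k * arctan w \<le> arctan (k * w)"
proof -
  let ?\<phi> = "\<lambda>w. arctan (k * w) - k * arctan w"
  have "?\<phi> 0 \<le> ?\<phi> w"
  proof (rule DERIV_nonneg_imp_nondecreasing[OF assms(3)], intro exI conjI)
    fix u :: real assume "0 \<le> u" "u \<le> w"
    show "(?\<phi> has_real_derivative k / (1 + (k * u)\<^sup>2) - k / (1 + u\<^sup>2)) (at u)"
      by (auto intro!: derivative_eq_intros simp: divide_inverse)
    have "(k * u)\<^sup>2 \<le> u\<^sup>2"
      using assms \<open>0 \<le> u\<close> by (intro power_mono mult_left_le_one_le) auto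
    then show "0 \<le> k / (1 + (k * u)\<^sup>2) - k / (1 + u\<^sup>2)"
      using assms by (simp add: divide_left_mono add_pos_nonneg)
  qed
  then show ?thesis by simp
qed

section \<open>Bounds and monotonicity of the edge curvature\<close>

context
  fixes \<theta> :: real
  assumes \<theta>: "0 < \<theta>" "\<theta> \<le> pi/2"
begin

lemma sin_cos_\<theta>: "0 < sin \<theta>" "0 \<le> cos \<theta>"
  using \<theta> by (auto intro!: sin_gt_zero cos_ge_zero)

lemma edge_curvature_nonneg: "0 \<le> edge_curvature \<theta> x y"
  unfolding edge_curvature_def using sin_cos_\<theta>
  by (intro divide_nonneg_nonneg mult_nonneg_nonneg) (auto simp: zero_le_arctan_iff add_nonneg_nonneg)

text \<open>The angle is at most \<open>pi\<close> and the cosine of the radius at most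
  \<open>exp (- x)\<close>. This decay keeps the coordinates of the flow bounded above.\<close>

lemma edge_curvature_le_exp: "edge_curvature \<theta> x y \<le> pi * exp (- x)"
proof -
  have "exp x \<le> sqrt (1 + exp (2 * x))"
    by (rule real_le_rsqrt) (simp add: exp_double)
  then show ?thesis
    unfolding edge_curvature_def exp_minus divide_inverse
    by (intro mult_mono le_imp_inverse_le two_arctan_le_pi) auto
qed

lemma edge_curvature_le: "edge_curvature \<theta> x y \<le> pi"
proof -
  have "edge_curvature \<theta> x y \<le> pi / 1"
    unfolding edge_curvature_def
    by (intro frac_le two_arctan_le_pi) auto
  then show ?thesis by simp
qed

lemma edge_curvature_mono_right:
  assumes "y \<le> y'"
  shows "edge_curvature \<theta> x y \<le> edge_curvature \<theta> x y'"
proof -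
  have "exp (x - y') + cos \<theta> \<le> exp (x - y) + cos \<theta>"
    using assms by simp
  then show ?thesis
    unfolding edge_curvature_def using sin_cos_\<theta>
    by (intro divide_right_mono mult_left_mono arctan_monotone' divide_left_mono)
      (auto intro!: mult_nonneg_nonneg mult_pos_pos add_pos_nonneg less_imp_le)
qed

text \<open>Put \<open>k = exp (x - x')\<close>. Passing from \<open>x\<close> to \<open>x'\<close>
  shrinks the argument of \<open>arctan\<close> by a factor no smaller than \<open>k\<close>, hence
  by concavity also the angle, and it shrinks the cosine of the radius by a factor no smaller than
  \<open>k\<close>. Together the loss is at most \<open>k * k\<close>.\<close>

lemma edge_curvature_scale:
  assumes "x \<le> x'"
  shows "exp (- (2 * (x' - x))) * edge_curvature \<theta> x y \<le> edge_curvature \<theta> x' y"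
proof -
  define k where "k = exp (x - x')"
  define A where "A = sqrt (1 + exp (2 * x))"
  define A' where "A' = sqrt (1 + exp (2 * x'))"
  define D where "D = exp (x - y) + cos \<theta>"
  define D' where "D' = exp (x' - y) + cos \<theta>"
  have k: "0 < k" "k \<le> 1"
    unfolding k_def using assms by auto
  have pos: "0 < A" "0 < A'" "0 < D" "0 < D'"
    unfolding A_def A'_def D_def D'_def using sin_cos_\<theta>
    by (auto intro!: sqrt_one_plus_exp_pos add_pos_nonneg)
  have "A \<le> A'"
    unfolding A_def A'_def using assms by simp
  have "k\<^sup>2 * (1 + exp (2 * x')) \<le> 1 + exp (2 * x)"
  proof -
    have "k\<^sup>2 * exp (2 * x') = exp (2 * x)"
      unfolding k_def exp_double[symmetric] by (simp flip: exp_add)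
    then show ?thesis
      using power_le_one[of k 2] k by (simp add: distrib_left)
  qed
  then have "sqrt (k\<^sup>2 * (1 + exp (2 * x'))) \<le> A"
    unfolding A_def by (rule real_sqrt_le_mono)
  then have kA: "k * A' \<le> A"
    using k by (simp add: A'_def real_sqrt_mult)
  have "k * exp (x' - y) = exp (x - y)"
    unfolding k_def by (simp flip: exp_add)
  then have kD: "k * D' \<le> D"
    unfolding D_def D'_def distrib_left
    using mult_right_mono[OF k(2) sin_cos_\<theta>(2)] by simp
  have "k * (sin \<theta> * A / D) \<le> sin \<theta> * A' / D'"
  proof -
    have "k * (sin \<theta> * A) * D' = (sin \<theta> * A) * (k * D')"
      by simp
    also have "\<dots> \<le> (sin \<theta> * A') * D"
      using kD \<open>A \<le> A'\<close> pos k sin_cos_\<theta> by (intro mult_mono) auto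
    finally show ?thesis
      using pos by (simp add: field_simps)
  qed
  then have "arctan (k * (sin \<theta> * A / D)) \<le> arctan (sin \<theta> * A' / D')"
    by (rule arctan_monotone')
  moreover have "k * arctan (sin \<theta> * A / D) \<le> arctan (k * (sin \<theta> * A / D))"
    using k pos sin_cos_\<theta> by (intro arctan_scale_le) auto
  ultimately have "k * arctan (sin \<theta> * A / D) \<le> arctan (sin \<theta> * A' / D')"
    by linarith
  then have "(k * arctan (sin \<theta> * A / D)) * (k * A') \<le> arctan (sin \<theta> * A' / D') * A"
    using kA k pos sin_cos_\<theta> by (intro mult_mono) (auto simp: zero_le_arctan_iff)
  then have "k * k * (2 * arctan (sin \<theta> * A / D) / A) \<le> 2 * arctan (sin \<theta> * A' / D') / A'"
    using pos by (simp add: field_simps)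
  moreover have "k * k = exp (- (2 * (x' - x)))"
    unfolding k_def by (simp flip: exp_add)
  ultimately show ?thesis
    unfolding edge_curvature_def A_def A'_def D_def D'_def by simp
qed

text \<open>Raising \<open>x\<close> by \<open>x' - x\<close> keeps at least the fraction
  \<open>exp (- 2 * (x' - x))\<close>, which is at least \<open>1 - 2 * (x' - x)\<close>. As the
  curvature is at most \<open>pi\<close>, the loss is at most
  \<open>2 * pi * (x' - x)\<close>.\<close>

lemma edge_curvature_quasi_mono:
  assumes "x \<le> x'" "y \<le> y'"
  shows "edge_curvature \<theta> x y + 2 * pi * x \<le> edge_curvature \<theta> x' y' + 2 * pi * x'"
proof -
  let ?d = "2 * (x' - x)"
  have "1 - ?d \<le> exp (- ?d)"
    using exp_ge_add_one_self[of "- ?d"] by linarith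
  then have "(1 - ?d) * edge_curvature \<theta> x y \<le> exp (- ?d) * edge_curvature \<theta> x y"
    by (rule mult_right_mono[OF _ edge_curvature_nonneg])
  also have "\<dots> \<le> edge_curvature \<theta> x' y"
    by (rule edge_curvature_scale[OF assms(1)])
  also have "\<dots> \<le> edge_curvature \<theta> x' y'"
    by (rule edge_curvature_mono_right[OF assms(2)])
  finally have "edge_curvature \<theta> x y - ?d * edge_curvature \<theta> x y \<le> edge_curvature \<theta> x' y'"
    by (simp add: algebra_simps)
  moreover have "?d * edge_curvature \<theta> x y \<le> ?d * pi"
    using edge_curvature_le assms by (intro mult_left_mono) auto
  ultimately show ?thesis
    by (simp add: algebra_simps)
qed

lemma continuous_on_edge_curvature:
  assumes "continuous_on A g" "continuous_on A h"
  shows "continuous_on A (\<lambda>x. edge_curvature \<theta> (g x) (h x))"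
proof -
  have "exp z + cos \<theta> \<noteq> 0" for z
    using sin_cos_\<theta> add_pos_nonneg[of "exp z" "cos \<theta>"] by simp
  moreover have "sqrt (1 + exp z) \<noteq> 0" for z :: real
    using sqrt_one_plus_exp_pos[of z] by linarith
  ultimately show ?thesis
    unfolding edge_curvature_def by (intro continuous_intros assms) auto
qed

end

section \<open>Total curvature and its flow\<close>

text \<open>The image of the closed interval is compact, hence closed in a Hausdorff space, so the
  closure of \<open>e\<close> adds at most the images of \<open>-1\<close> and
  \<open>1\<close>.\<close>

lemma endpoints_of_edge:
  fixes S :: "'s topology"
  assumes "Hausdorff_space S" "cellular_decomposition S V E F" "e \<in> E"
  shows "\<exists>a\<in>V. \<exists>b\<in>V. endpoints S e \<subseteq> {a, b}"
proof -
  have "\<forall>e\<in>E. \<exists>\<phi> :: real \<Rightarrow> 's. characteristic_map S V e \<phi>"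
    using assms(2) unfolding cellular_decomposition_def by (elim conjE)
  then obtain \<phi> :: "real \<Rightarrow> 's" where \<phi>: "characteristic_map S V e \<phi>"
    using assms(3) by blast
  have cont: "continuous_map (top_of_set (cball 0 1)) S \<phi>"
    and ball: "\<phi> ` ball 0 1 = e" and sphere: "\<phi> ` sphere 0 1 \<subseteq> V"
    using \<phi> unfolding characteristic_map_def by blast+
  have "compactin (top_of_set (cball 0 1)) (cball (0::real) 1)"
    by (simp add: compactin_subtopology)
  then have "closedin S (\<phi> ` cball 0 1)"
    using compactin_imp_closedin[OF assms(1) image_compactin[OF _ cont]] by simp
  then have "S closure_of e \<subseteq> \<phi> ` cball 0 1"
    unfolding ball[symmetric] by (intro closure_of_minimal image_mono ball_subset_cball)
  moreover have sph: "sphere (0::real) 1 = {-1, 1}"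
    by (auto simp: abs_if split: if_splits)
  have "cball (0::real) 1 = ball 0 1 \<union> {-1, 1}"
    unfolding sph[symmetric] by (intro set_eqI) (simp add: le_less)
  then have "\<phi> ` cball 0 1 = e \<union> {\<phi> (-1), \<phi> 1}"
    by (simp only: image_Un ball image_insert image_empty)
  ultimately have "endpoints S e \<subseteq> {\<phi> (-1), \<phi> 1}"
    unfolding endpoints_def by blast
  moreover have "\<phi> (-1) \<in> V" "\<phi> 1 \<in> V"
    using sphere unfolding sph by simp_all
  ultimately show ?thesis by blast
qed

text \<open>With at most two endpoints, the one other than \<open>v\<close> is unique. Hence total
  curvatures at vertices see only the radii on \<open>V\<close>.\<close>

lemma opposite_endpoint_in:
  assumes "Hausdorff_space S" "cellular_decomposition S V E F" "e \<in> E" "v \<in> endpoints S e"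
  shows "opposite_endpoint S e v \<in> V"
proof -
  obtain a b where ab: "a \<in> V" "b \<in> V" "endpoints S e \<subseteq> {a, b}"
    using endpoints_of_edge[OF assms(1-3)] by blast
  show ?thesis
  proof (cases "endpoints S e = {v}")
    case True
    then show ?thesis
      using ab by (auto simp: opposite_endpoint_def)
  next
    case False
    then obtain w where w: "w \<in> endpoints S e" "w \<noteq> v"
      using assms(4) by blast
    have "(THE w. w \<in> endpoints S e \<and> w \<noteq> v) = w"
      using w ab assms(4) by (intro the_equality) blast+
    then show ?thesis
      using False w ab by (auto simp: opposite_endpoint_def)
  qed
qed

lemma incident_edgesD:
  "e \<in> incident_edges S E {v} \<Longrightarrow> e \<in> E" "e \<in> incident_edges S E {v} \<Longrightarrow> v \<in> endpoints S e"
  by (auto simp: incident_edges_def)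

lemma total_curvature_arctan_exp:
  assumes "intersection_angle E \<Theta>"
  shows "total_curvature S E \<Theta> (\<lambda>v. arctan (exp (x v))) v =
    (\<Sum>e\<in>incident_edges S E {v}. (if endpoints S e = {v} then 2 else 1) *
       edge_curvature (\<Theta> e) (x v) (x (opposite_endpoint S e v)))"
  unfolding total_curvature_def cone_angle_def edge_angle_def sum_distrib_right
proof (rule sum.cong[OF refl])
  fix e assume "e \<in> incident_edges S E {v}"
  then have "0 < \<Theta> e" "\<Theta> e \<le> pi/2"
    using assms by (auto simp: intersection_angle_def dest: incident_edgesD)
  then show "(if endpoints S e = {v} then 2 else 1) *
      quad_angle (\<Theta> e) (arctan (exp (x v))) (arctan (exp (x (opposite_endpoint S e v)))) *
      cos (arctan (exp (x v))) =
    (if endpoints S e = {v} then 2 else 1) *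
      edge_curvature (\<Theta> e) (x v) (x (opposite_endpoint S e v))"
    by (simp add: edge_curvature_eq mult.assoc)
qed

lemma total_curvature_cong:
  assumes "Hausdorff_space S" "cellular_decomposition S V E F" "v \<in> V" "\<And>w. w \<in> V \<Longrightarrow> r w = r' w"
  shows "total_curvature S E \<Theta> r v = total_curvature S E \<Theta> r' v"
proof -
  have "r (opposite_endpoint S e v) = r' (opposite_endpoint S e v)"
    if "e \<in> incident_edges S E {v}" for e
    using assms(4)[OF opposite_endpoint_in[OF assms(1,2) incident_edgesD[OF that]]] .
  with assms(3,4) show ?thesis
    unfolding total_curvature_def cone_angle_def edge_angle_def by simp
qed

text \<open>For \<open>r = arctan (exp x)\<close> one has \<open>r' = x' * sin r * cos r\<close>;
  this is the change of variables that gives the flow its factor \<open>sin (2 * r)\<close>.\<close>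

lemma arctan_exp_has_derivative:
  assumes "(x has_real_derivative D) (at t within A)"
  shows "((\<lambda>t. arctan (exp (x t))) has_real_derivative D / 2 * sin (2 * arctan (exp (x t)))) (at t within A)"
proof -
  have "((\<lambda>t. exp (x t)) has_real_derivative exp (x t) * D) (at t within A)"
    by (rule DERIV_chain2[OF DERIV_exp assms])
  from DERIV_chain2[OF DERIV_arctan this] show ?thesis
    by (simp add: sin_double sin_arctan cos_arctan field_simps)
qed

theorem theorem1p3:
  fixes S :: "'s topology" and V :: "'s set" and E F :: "'s set set"
    and \<Theta> :: "'s set \<Rightarrow> real" and r0 That :: "'s \<Rightarrow> real"
  assumes "surface S"
    and "cellular_decomposition S V E F"
    and "countable V" and "infinite V"
    and "locally_finite_decomposition S V E"
    and "intersection_angle E \<Theta>"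
    and "circle_pattern_metric V r0"
    and "\<forall>v\<in>V. That v > 0"
    and "\<forall>U\<subseteq>V. U \<noteq> {} \<longrightarrow>
           (\<Sum>\<^sub>\<infinity>v\<in>U. ennreal (That v)) < 2 * (\<Sum>\<^sub>\<infinity>e\<in>incident_edges S E U. ennreal (\<Theta> e))"
    and "\<forall>v\<in>V. total_curvature S E \<Theta> r0 v \<ge> That v"
  shows "\<exists>r :: real \<Rightarrow> 's \<Rightarrow> real.
           flow_solution S V E \<Theta> That r \<and>
           (\<forall>v\<in>V. r 0 v = r0 v) \<and>
           (\<exists>rlim. circle_pattern_metric V rlim \<and>
              (\<forall>v\<in>V. ((\<lambda>t. r t v) \<longlongrightarrow> rlim v) at_top)) \<and>
           (\<forall>v\<in>V. ((\<lambda>t. total_curvature S E \<Theta> (r t) v) \<longlongrightarrow> That v) at_top)"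
proof -
  have haus: "Hausdorff_space S"
    using assms(1) by (simp add: surface_def)
  define I where "I = (\<lambda>v. incident_edges S E {v})"
  define m where "m = (\<lambda>e v. if endpoints S e = {v} then 2 else 1 :: real)"
  have m: "0 \<le> m e v" for e v
    by (simp add: m_def)
  have \<Theta>: "0 < \<Theta> e" "\<Theta> e \<le> pi/2" if "e \<in> I v" for e v
    using assms(6) that by (auto simp: I_def intersection_angle_def dest: incident_edgesD)
  define T where "T = (\<lambda>x v. total_curvature S E \<Theta> (\<lambda>v. arctan (exp (x v))) v)"
  have T: "T x v = (\<Sum>e\<in>I v. m e v * edge_curvature (\<Theta> e) (x v) (x (opposite_endpoint S e v)))"
    for x v
    unfolding T_def I_def m_def by (rule total_curvature_arctan_exp[OF assms(6)])
  \<comment> \<open>The coordinates outside \<open>V\<close> are dummies, which rest at \<open>0\<close>.\<close>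
  define f where "f = (\<lambda>x v. if v \<in> V then T x v - That v else - max 0 (x v))"
  \<comment> \<open>\<open>pi\<close> for each corner at \<open>v\<close>, loops counting twice: a
    bound for the total curvature.\<close>
  define C where "C = (\<lambda>v. \<Sum>e\<in>I v. m e v * pi)"
  define x0 where "x0 = (\<lambda>v. if v \<in> V then ln (tan (r0 v)) else 0)"
  have x0: "arctan (exp (x0 v)) = r0 v" if "v \<in> V" for v
  proof -
    have "0 < r0 v" "r0 v < pi/2"
      using assms(7) that by (auto simp: circle_pattern_metric_def)
    then show ?thesis
      using that by (simp add: x0_def tan_gt_zero arctan_tan)
  qed
  \<comment> \<open>Each corner needs \<open>2 * pi\<close> in the quasi-monotonicity, which sums to
    \<open>2 * C v\<close>. For a dummy coordinate \<open>z - max 0 z\<close> is nondecreasing in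
    \<open>z\<close>, so the constants \<open>1\<close> and \<open>0\<close> serve.\<close>
  interpret cooperative_flow f "\<lambda>v. if v \<in> V then 2 * C v else 1" "\<lambda>v. if v \<in> V then C v else 0" x0
  proof
    fix v
    show "continuous_on UNIV (\<lambda>x. f x v)"
      unfolding f_def T
      by (cases "v \<in> V") (auto intro!: continuous_intros continuous_on_edge_curvature \<Theta>)
    show "0 \<le> (if v \<in> V then 2 * C v else 1)"
      by (simp add: C_def sum_nonneg m)
    show "0 \<le> f x0 v"
    proof (cases "v \<in> V")
      case True
      have "T x0 v = total_curvature S E \<Theta> r0 v"
        unfolding T_def by (rule total_curvature_cong[OF haus assms(2) True x0])
      with True assms(10) show ?thesis
        by (simp add: f_def)
    qed (simp add: f_def x0_def)
    fix x
    have "T x v \<le> C v"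
      unfolding T C_def by (intro sum_mono mult_left_mono edge_curvature_le m \<Theta>)
    then show "f x v \<le> (if v \<in> V then C v else 0)"
      using assms(8) by (auto simp: f_def)
    fix y :: "'s \<Rightarrow> real"
    assume le: "\<And>v. x v \<le> y v"
    have "T x v + 2 * C v * x v \<le> T y v + 2 * C v * y v"
    proof -
      have *: "T z v + 2 * C v * z v = (\<Sum>e\<in>I v. m e v *
          (edge_curvature (\<Theta> e) (z v) (z (opposite_endpoint S e v)) + 2 * pi * z v))" for z
        unfolding T C_def sum_distrib_left sum_distrib_right sum.distrib[symmetric]
        by (intro sum.cong) (auto simp: algebra_simps)
      show ?thesis
        unfolding * by (intro sum_mono mult_left_mono edge_curvature_quasi_mono m \<Theta> le)
    qed
    then show "f x v + (if v \<in> V then 2 * C v else 1) * x v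
        \<le> f y v + (if v \<in> V then 2 * C v else 1) * y v"
      using le[of v] by (auto simp: f_def max_def)
  qed
  \<comment> \<open>At a vertex the exponential decay of the curvature is played against
    \<open>That v > 0\<close>; at a dummy coordinate \<open>0 \<le> - max 0 (x v)\<close> forces
    \<open>x v \<le> 0\<close>.\<close>
  have bound: "x v \<le> (if v \<in> V then ln (C v / That v) else 0)" if "0 \<le> f x v" for x v
  proof (cases "v \<in> V")
    case True
    have "That v \<le> T x v"
      using that True by (simp add: f_def)
    also have "\<dots> \<le> (\<Sum>e\<in>I v. m e v * (pi * exp (- x v)))"
      unfolding T by (intro sum_mono mult_left_mono edge_curvature_le_exp m \<Theta>)
    also have "\<dots> = C v * exp (- x v)"
      by (simp add: C_def sum_distrib_right mult.assoc)
    finally have *: "exp (x v) \<le> C v / That v"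
      using assms(8) True by (simp add: exp_minus field_simps)
    then have "0 < C v / That v"
      using exp_gt_zero[of "x v"] by linarith
    with * True show ?thesis
      by (simp add: ln_ge_iff)
  qed (use that in \<open>simp add: f_def\<close>)
  have "\<exists>y. \<forall>v. ((\<lambda>t. flow t v) \<longlongrightarrow> y v) at_top \<and> ((\<lambda>t. f (flow t) v) \<longlongrightarrow> 0) at_top"
    by (rule flow_converges) (rule bound)
  then obtain y where y: "\<And>v. ((\<lambda>t. flow t v) \<longlongrightarrow> y v) at_top"
    and f0: "\<And>v. ((\<lambda>t. f (flow t) v) \<longlongrightarrow> 0) at_top"
    by blast
  define r where "r = (\<lambda>t v. arctan (exp (flow t v)))"
  have metric: "circle_pattern_metric V (\<lambda>v. arctan (exp (z v)))" for z
    using arctan_ubound by (simp add: circle_pattern_metric_def)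
  have fT: "f (flow t) v = total_curvature S E \<Theta> (r t) v - That v" if "v \<in> V" for t v
    using that by (simp add: f_def T_def r_def)
  show ?thesis
  proof (intro exI conjI ballI)
    show "flow_solution S V E \<Theta> That r"
      unfolding flow_solution_def
    proof (intro conjI allI impI ballI)
      fix t :: real and v assume t: "0 \<le> t" and v: "v \<in> V"
      show "((\<lambda>s. r s v) has_real_derivative
           (total_curvature S E \<Theta> (r t) v - That v) / 2 * sin (2 * r t v)) (at t within {0..})"
        unfolding fT[OF v, symmetric] unfolding r_def
        by (rule arctan_exp_has_derivative[OF flow_has_derivative[OF t]])
    qed (simp add: r_def metric)
    show "r 0 v = r0 v" if "v \<in> V" for v
      using x0[OF that] by (simp add: r_def flow_0)
    show "circle_pattern_metric V (\<lambda>v. arctan (exp (y v)))"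
      by (rule metric)
    show "((\<lambda>t. r t v) \<longlongrightarrow> arctan (exp (y v))) at_top" for v
      unfolding r_def by (intro tendsto_intros y)
    show "((\<lambda>t. total_curvature S E \<Theta> (r t) v) \<longlongrightarrow> That v) at_top" if "v \<in> V" for v
      using tendsto_add[OF f0[of v] tendsto_const[of "That v"]] by (simp add: fT[OF that])
  qed
qed

end
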